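(* Let $N,P\in\mathbb{N}$, let $\sigma=(\sigma_1,\dots,\sigma_P)\in\mathbb{R}^{N\times P}$ (with columns $\sigma_i\in\mathbb{R}^N$), and let $\mu$ be a nonnegative symmetric Radon measure on $\mathbb{R}^N\setminus\{0\}$ satisfying $\int_{|z|>0}\min\{|z|^2,1\}\,\mathrm{d}\mu(z)<\infty$. Assume that either $\sigma\not\equiv0$ or $\operatorname{supp}\mu\neq\emptyset$. If $v\in C_0(\mathbb{R}^N)$ satisfies $\mathfrak{L}^{\sigma,\mu}[v]=0$ in $\mathcal{D}'(\mathbb{R}^N)$, i.e. $\int_{\mathbb{R}^N}v\,\mathfrak{L}^{\sigma,\mu}[\psi]\,\mathrm{d}x=0$ for all $\psi\in C_c^\infty(\mathbb{R}^N)$, then $v\equiv0$ on $\mathbb{R}^N$.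
   Context: $C_0(\mathbb{R}^N)$ denotes the continuous functions on $\mathbb{R}^N$ vanishing at infinity. For $\psi\in C_c^\infty(\mathbb{R}^N)$ the operator is $\mathfrak{L}^{\sigma,\mu}[\psi]:=L^\sigma[\psi]+\mathcal{L}^\mu[\psi]$, where $L^\sigma[\psi](x):=\mathrm{tr}(\sigma\sigma^T D^2\psi(x))=\sum_{i=1}^P(\sigma_i\cdot D)^2\psi(x)$ and $\mathcal{L}^\mu[\psi](x):=\int_{\mathbb{R}^N\setminus\{0\}}\big(\psi(x+z)-\psi(x)-z\cdot D\psi(x)\mathbf{1}_{|z|\le 1}\big)\,\mathrm{d}\mu(z)$. *)

theory Defs
  imports "HOL-Analysis.Analysis"
begin

definition dirderiv :: "'a::euclidean_space \<Rightarrow> ('a \<Rightarrow> real) \<Rightarrow> 'a \<Rightarrow> real" where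
  "dirderiv v f x = frechet_derivative f (at x) v"

fun iter_dirderiv :: "'a::euclidean_space list \<Rightarrow> ('a \<Rightarrow> real) \<Rightarrow> 'a \<Rightarrow> real" where
  "iter_dirderiv [] f = f"
| "iter_dirderiv (v # vs) f = dirderiv v (iter_dirderiv vs f)"

definition smooth_fun :: "('a::euclidean_space \<Rightarrow> real) \<Rightarrow> bool" where
  "smooth_fun f \<longleftrightarrow> (\<forall>vs x. iter_dirderiv vs f differentiable (at x))"

definition test_fun :: "('a::euclidean_space \<Rightarrow> real) \<Rightarrow> bool" where
  "test_fun f \<longleftrightarrow> smooth_fun f \<and> compact (closure {x. f x \<noteq> 0})"

definition C0_fun :: "('a::euclidean_space \<Rightarrow> real) \<Rightarrow> bool" where
  "C0_fun v \<longleftrightarrow> continuous_on UNIV v \<and> (v \<longlongrightarrow> 0) at_infinity"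

definition loc_op :: "nat \<Rightarrow> (nat \<Rightarrow> 'a::euclidean_space) \<Rightarrow> ('a \<Rightarrow> real) \<Rightarrow> 'a \<Rightarrow> real" where
  "loc_op P \<sigma> \<psi> x = (\<Sum>i<P. dirderiv (\<sigma> i) (dirderiv (\<sigma> i) \<psi>) x)"

text \<open>Nonlocal part (the measure lives on R^N with no mass at 0, i.e. on R^N minus 0).\<close>
definition nonloc_op :: "'a::euclidean_space measure \<Rightarrow> ('a \<Rightarrow> real) \<Rightarrow> 'a \<Rightarrow> real" where
  "nonloc_op \<mu> \<psi> x = (LINT z:(UNIV - {0})|\<mu>.
      \<psi> (x + z) - \<psi> x - (if norm z \<le> 1 then dirderiv z \<psi> x else 0))"

definition levy_op :: "nat \<Rightarrow> (nat \<Rightarrow> 'a::euclidean_space) \<Rightarrow> 'a measure \<Rightarrow> ('a \<Rightarrow> real) \<Rightarrow> 'a \<Rightarrow> real" where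
  "levy_op P \<sigma> \<mu> \<psi> x = loc_op P \<sigma> \<psi> x + nonloc_op \<mu> \<psi> x"

definition measure_supp :: "'a::euclidean_space measure \<Rightarrow> 'a set" where
  "measure_supp \<mu> = {x. x \<noteq> 0 \<and> (\<forall>e>0. emeasure \<mu> (ball x e - {0}) > 0)}"

end

theory Submission
  imports Defs
begin

text \<open>Suppose \<open>v\<close> is positive at some point. Its mollification \<open>w\<close> by a narrow bump is then positive
  there as well, still lies in \<open>C\<^sub>0\<close>, and by Fubini satisfies the equation pointwise. If the
  support of the measure contains some \<open>z \<noteq> 0\<close>, then at a maximum point \<open>c\<close> of \<open>w\<close> the local and the
  nonlocal part are both nonpositive, hence both vanish, so that \<open>w (c - z) = w c\<close>; iterating, \<open>w\<close>
  takes its positive maximum at all \<open>c - n z\<close>, which contradicts decay at infinity. Otherwise the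
  measure vanishes, and \<open>w + \<epsilon> (\<sigma>\<^sub>i \<bullet> x)\<^sup>2\<close> with \<open>\<sigma>\<^sub>i \<noteq> 0\<close> has an interior maximum in a large
  ball, where the local part of \<open>w\<close> would be strictly negative. The same applies to \<open>- v\<close>.\<close>

section \<open>A smooth bump function\<close>

text \<open>\<open>flat 0\<close> is the classical function \<open>exp (- 1/t)\<close>, extended by
  zero. The extra powers of \<open>1/t\<close> make the family closed under differentiation up to
  linear combinations.\<close>

definition flat :: "nat \<Rightarrow> real \<Rightarrow> real" where
  "flat k t = (if t \<le> 0 then 0 else exp (- inverse t) * inverse t ^ k)"

lemma flat_nonneg: "flat k t \<ge> 0"
  by (simp add: flat_def)

lemma flat_0_pos: "t > 0 \<Longrightarrow> flat 0 t > 0"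
  by (simp add: flat_def)

text \<open>With \<open>s = 1/t\<close> this is the decay of \<open>s ^ k / exp s\<close> as
  \<open>s\<close> tends to infinity.\<close>

lemma flat_tendsto_0: "(flat k \<longlongrightarrow> 0) (at_right 0)"
proof -
  have "((\<lambda>t. inverse t ^ k / exp (inverse t)) \<longlongrightarrow> (0::real)) (at_right 0)"
    by (rule filterlim_compose[OF tendsto_power_div_exp_0 filterlim_inverse_at_top_right])
  moreover have "\<forall>\<^sub>F t in at_right 0. inverse t ^ k / exp (inverse t) = flat k t"
    by (auto simp: eventually_at_filter flat_def exp_minus divide_inverse mult.commute)
  ultimately show ?thesis
    using tendsto_cong by fastforce
qed

lemma DERIV_flat: "(flat k has_real_derivative flat (k + 2) t - real k * flat (k + 1) t) (at t)"
proof (cases t "0::real" rule: linorder_cases)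
  case less
  have "((\<lambda>_. 0) has_real_derivative 0) (at t)" by simp
  then have "(flat k has_real_derivative 0) (at t)"
    by (rule DERIV_cong_ev[THEN iffD1, rotated 3, OF _])
       (use less in \<open>auto simp: flat_def intro!: eventually_mono[OF eventually_nhds_in_open[of "{..<0}" t]]\<close>)
  with less show ?thesis by (simp add: flat_def)
next
  case greater
  have "((\<lambda>t. exp (- inverse t) * inverse t ^ k) has_real_derivative
      flat (k + 2) t - real k * flat (k + 1) t) (at t)"
  proof -
    \<comment> \<open>For \<open>k = 0\<close> the truncated exponent is harmless, because the
      factor \<open>real k\<close> vanishes.\<close>
    have "real k * inverse t ^ (k - Suc 0) * (inverse t * inverse t) = real k * inverse t ^ (k + 1)"
      by (cases k) auto
    then show ?thesis
      using greater
      by (auto intro!: derivative_eq_intros simp: flat_def algebra_simps)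
  qed
  then show ?thesis
    by (rule DERIV_cong_ev[THEN iffD1, rotated 3, OF _])
       (use greater in \<open>auto simp: flat_def intro!: eventually_mono[OF eventually_nhds_in_open[of "{0<..}" t]]\<close>)
next
  case equal
  \<comment> \<open>For \<open>h > 0\<close> the difference quotient at 0 is
    \<open>flat (Suc k) h\<close>, so the limit for the next index gives the derivative.\<close>
  have "((\<lambda>h. flat k h / h) \<longlongrightarrow> 0) (at_right 0)"
    by (rule Lim_transform_eventually[OF flat_tendsto_0[of "Suc k"]])
       (auto simp: eventually_at_filter flat_def divide_inverse mult_ac)
  moreover have "((\<lambda>h. flat k h / h) \<longlongrightarrow> 0) (at_left 0)"
    by (rule Lim_transform_eventually[OF tendsto_const]) (auto simp: eventually_at_filter flat_def)
  ultimately have "((\<lambda>h. flat k h / h) \<longlongrightarrow> 0) (at 0)"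
    by (simp add: filterlim_split_at)
  with equal show ?thesis
    by (simp add: DERIV_def flat_def)
qed

text \<open>A class that contains the bump and is stable under directional derivatives. Smoothness
  then follows by induction on the list of directions, without any formula for iterated
  derivatives.\<close>

inductive_set bump_algebra :: "real \<Rightarrow> 'a::euclidean_space \<Rightarrow> ('a \<Rightarrow> real) set"
  for r c where
  const: "(\<lambda>_. a) \<in> bump_algebra r c"
| coord: "(\<lambda>x. x \<bullet> b) \<in> bump_algebra r c"
| flat: "(\<lambda>x. flat k (r\<^sup>2 - (x - c) \<bullet> (x - c))) \<in> bump_algebra r c"
| add: "f \<in> bump_algebra r c \<Longrightarrow> g \<in> bump_algebra r c \<Longrightarrow> (\<lambda>x. f x + g x) \<in> bump_algebra r c"
| mult: "f \<in> bump_algebra r c \<Longrightarrow> g \<in> bump_algebra r c \<Longrightarrow> (\<lambda>x. f x * g x) \<in> bump_algebra r c"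

lemma bump_algebra_derivative:
  assumes "f \<in> bump_algebra r c"
  shows "\<exists>D. (\<forall>x. (f has_derivative D x) (at x)) \<and> (\<forall>z. (\<lambda>x. D x z) \<in> bump_algebra r c)"
  using assms
proof induction
  case (const a)
  then show ?case by (intro exI[of _ "\<lambda>_ _. 0"]) (auto intro: bump_algebra.const)
next
  case (coord b)
  show ?case
    by (intro exI[of _ "\<lambda>_ z. z \<bullet> b"])
       (auto intro: bump_algebra.const intro!: derivative_eq_intros)
next
  case (flat k)
  define q where "q x = r\<^sup>2 - (x - c) \<bullet> (x - c)" for x
  \<comment> \<open>This is \<open>-2 ((x - c) \<bullet> z)\<close>, written as a sum of products of
    constants and a coordinate so that it visibly lies in the class, which has no rule for
    subtraction.\<close>
  define q' where "q' x z = (-2) * (x \<bullet> z) + 2 * (c \<bullet> z)" for x z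
  have q: "(q has_derivative q' x) (at x)" for x
    unfolding q_def q'_def
    by (auto intro!: derivative_eq_intros simp: algebra_simps inner_commute)
  show ?case
  proof (intro exI conjI allI)
    fix x
    show "((\<lambda>x. flat k (r\<^sup>2 - (x - c) \<bullet> (x - c))) has_derivative
       (\<lambda>z. (flat (k + 2) (q x) + (- real k) * flat (k + 1) (q x)) * q' x z)) (at x)"
      using DERIV_compose_FDERIV[OF DERIV_flat q, of k x]
      by (simp add: q_def[symmetric] mult.commute)
  next
    fix z
    show "(\<lambda>x. (flat (k + 2) (q x) + (- real k) * flat (k + 1) (q x)) * q' x z) \<in> bump_algebra r c"
      unfolding q_def q'_def by (intro bump_algebra.intros)
  qed
next
  case (add f g)
  then obtain D E where "\<forall>x. (f has_derivative D x) (at x)" "\<forall>z. (\<lambda>x. D x z) \<in> bump_algebra r c"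
    "\<forall>x. (g has_derivative E x) (at x)" "\<forall>z. (\<lambda>x. E x z) \<in> bump_algebra r c"
    by blast
  then show ?case
    by (intro exI[of _ "\<lambda>x z. D x z + E x z"]) (auto intro!: bump_algebra.add derivative_intros)
next
  case (mult f g)
  then obtain D E where "\<forall>x. (f has_derivative D x) (at x)" "\<forall>z. (\<lambda>x. D x z) \<in> bump_algebra r c"
    "\<forall>x. (g has_derivative E x) (at x)" "\<forall>z. (\<lambda>x. E x z) \<in> bump_algebra r c"
    by blast
  with mult.hyps show ?case
    by (intro exI[of _ "\<lambda>x z. f x * E x z + D x z * g x"])
       (auto intro!: bump_algebra.add bump_algebra.mult derivative_intros)
qed

lemma dirderiv_eqI: "(f has_derivative D) (at x) \<Longrightarrow> dirderiv z f x = D z"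
  by (simp add: dirderiv_def frechet_derivative_at[symmetric])

lemma bump_algebra_smooth:
  assumes "f \<in> bump_algebra r c"
  shows "smooth_fun f"
proof -
  have "iter_dirderiv vs f \<in> bump_algebra r c" for vs
  proof (induction vs)
    case (Cons z vs)
    then obtain D where D: "\<forall>x. (iter_dirderiv vs f has_derivative D x) (at x)"
      "(\<lambda>x. D x z) \<in> bump_algebra r c"
      using bump_algebra_derivative by blast
    then have "iter_dirderiv (z # vs) f = (\<lambda>x. D x z)"
      by (auto simp: dirderiv_eqI)
    with D show ?case by simp
  qed (simp add: assms)
  then show ?thesis
    unfolding smooth_fun_def differentiable_def using bump_algebra_derivative by blast
qed

text \<open>The argument of \<open>flat\<close> is a polynomial in \<open>x\<close>, positive
  exactly where \<open>norm (x - c) < r\<close> if \<open>r > 0\<close>. The integral is not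
  normalised, since only signs and equalities of values matter later.\<close>

definition bump :: "real \<Rightarrow> 'a::euclidean_space \<Rightarrow> 'a \<Rightarrow> real" where
  "bump r c x = flat 0 (r\<^sup>2 - (x - c) \<bullet> (x - c))"

lemma smooth_bump: "smooth_fun (bump r c)"
  unfolding bump_def by (rule bump_algebra_smooth) (rule bump_algebra.flat)

lemma bump_nonneg: "bump r c x \<ge> 0"
  by (simp add: bump_def flat_nonneg)

lemma bump_center_pos: "r > 0 \<Longrightarrow> bump r c c > 0"
  by (simp add: bump_def flat_0_pos)

lemma bump_outside: "r \<ge> 0 \<Longrightarrow> x \<notin> cball c r \<Longrightarrow> bump r c x = 0"
  by (simp add: bump_def flat_def dot_square_norm dist_norm norm_minus_commute power_mono)

text \<open>A shift of the argument moves the centre the opposite way; this is why mollifications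
  are later evaluated at \<open>c - z\<close>.\<close>

lemma bump_translate: "bump r c (x + z) = bump r (c - z) x"
  by (simp add: bump_def algebra_simps)

lemma test_fun_bump:
  assumes "r \<ge> 0"
  shows "test_fun (bump r c)"
proof -
  have "{x. bump r c x \<noteq> 0} \<subseteq> cball c r"
    using bump_outside[OF assms, of _ c] by blast
  then show ?thesis
    using bounded_subset[OF bounded_cball] by (auto simp: test_fun_def smooth_bump compact_closure)
qed

section \<open>Taylor bounds for smooth functions of compact support\<close>

lemma iter_dirderiv_append: "iter_dirderiv (vs @ ws) f = iter_dirderiv vs (iter_dirderiv ws f)"
  by (induction vs) auto

lemma smooth_fun_dirderiv: "smooth_fun f \<Longrightarrow> smooth_fun (dirderiv z f)"
  unfolding smooth_fun_def by (metis iter_dirderiv.simps iter_dirderiv_append)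

lemma smooth_fun_funpow: "smooth_fun f \<Longrightarrow> smooth_fun ((dirderiv z ^^ n) f)"
  by (induction n) (auto intro: smooth_fun_dirderiv)

lemma smooth_fun_has_derivative:
  "smooth_fun f \<Longrightarrow> (f has_derivative (\<lambda>z. dirderiv z f x)) (at x)"
  unfolding smooth_fun_def dirderiv_def
  by (metis (no_types, lifting) ext frechet_derivative_works iter_dirderiv.simps(1))

lemma smooth_fun_continuous_on: "smooth_fun f \<Longrightarrow> continuous_on A f"
  by (meson continuous_at_imp_continuous_on has_derivative_continuous smooth_fun_has_derivative)

text \<open>Reduces all directions to finitely many partial derivatives, which yields joint
  measurability in \<open>z\<close> and \<open>x\<close> as well as bounds uniform in
  \<open>z\<close>.\<close>

lemma dirderiv_basis:
  assumes "smooth_fun f"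
  shows "dirderiv z f x = (\<Sum>b\<in>Basis. (z \<bullet> b) * dirderiv b f x)"
proof -
  have "linear (\<lambda>z. dirderiv z f x)"
    using smooth_fun_has_derivative[OF assms] has_derivative_linear by blast
  then have "(\<lambda>z. dirderiv z f x) (\<Sum>b\<in>Basis. (z \<bullet> b) *\<^sub>R b) = (\<Sum>b\<in>Basis. (z \<bullet> b) *\<^sub>R dirderiv b f x)"
    by (subst linear_sum[of "\<lambda>z. dirderiv z f x"]) (simp_all add: linear_cmul[of "\<lambda>z. dirderiv z f x"])
  then show ?thesis
    by (simp add: euclidean_representation)
qed

lemma dirderiv_basis2:
  assumes "smooth_fun f"
  shows "dirderiv z (dirderiv z f) x =
    (\<Sum>a\<in>Basis. \<Sum>b\<in>Basis. (z \<bullet> a) * (z \<bullet> b) * dirderiv a (dirderiv b f) x)"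
proof -
  have "dirderiv a (dirderiv z f) x = (\<Sum>b\<in>Basis. (z \<bullet> b) * dirderiv a (dirderiv b f) x)" for a
  proof -
    have "dirderiv z f = (\<lambda>y. \<Sum>b\<in>Basis. (z \<bullet> b) * dirderiv b f y)"
      using dirderiv_basis[OF assms] by (rule ext)
    moreover have "((\<lambda>y. \<Sum>b\<in>Basis. (z \<bullet> b) * dirderiv b f y) has_derivative
       (\<lambda>a. \<Sum>b\<in>Basis. (z \<bullet> b) * dirderiv a (dirderiv b f) x)) (at x)"
      by (rule has_derivative_sum, rule has_derivative_mult_right,
          rule smooth_fun_has_derivative, rule smooth_fun_dirderiv, rule assms)
    ultimately show ?thesis
      by (simp only: dirderiv_eqI)
  qed
  then show ?thesis
    by (subst dirderiv_basis[OF smooth_fun_dirderiv[OF assms]])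
       (simp add: sum_distrib_left mult.assoc)
qed

lemma dirderiv_outside:
  assumes "closed S" "\<And>x. x \<notin> S \<Longrightarrow> f x = 0" "x \<notin> S"
  shows "dirderiv z f x = 0"
proof -
  have "((\<lambda>_. 0) has_derivative (\<lambda>_. 0)) (at x)" by simp
  then have "(f has_derivative (\<lambda>_. 0)) (at x)"
    by (rule has_derivative_transform_within_open[of _ _ _ _ "- S"]) (use assms in auto)
  then show ?thesis by (rule dirderiv_eqI)
qed

lemma funpow_dirderiv_outside:
  assumes "closed S" "\<And>x. x \<notin> S \<Longrightarrow> f x = 0" "x \<notin> S"
  shows "(dirderiv z ^^ n) f x = 0"
  using assms(3) by (induction n arbitrary: x) (auto intro: dirderiv_outside[OF assms(1)] assms(2))

lemma compact_support_bounded: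
  fixes f :: "'a::euclidean_space \<Rightarrow> real"
  assumes "continuous_on UNIV f" "compact S" "\<And>x. x \<notin> S \<Longrightarrow> f x = 0"
  obtains K where "K \<ge> 0" "\<And>x. \<bar>f x\<bar> \<le> K"
proof -
  have "bounded (f ` S)"
    using assms by (intro compact_imp_bounded compact_continuous_image) (auto intro: continuous_on_subset)
  then obtain K where "\<And>x. x \<in> S \<Longrightarrow> \<bar>f x\<bar> \<le> K"
    unfolding bounded_iff by auto
  then have "\<bar>f x\<bar> \<le> max K 0" for x
    using assms(3)[of x] by (cases "x \<in> S") (auto intro: max.coboundedI1)
  then show ?thesis using that[of "max K 0"] by auto
qed

text \<open>Maclaurin's formula with Lagrange remainder for the restriction of \<open>f\<close> to
  the line through \<open>y\<close> in direction \<open>z\<close>, whose \<open>m\<close>-th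
  derivative is the \<open>m\<close>-fold directional derivative.\<close>

lemma smooth_fun_taylor:
  assumes "smooth_fun f"
  obtains s where "\<bar>s\<bar> \<le> \<bar>t\<bar>"
    "f (y + t *\<^sub>R z) = (\<Sum>m<n. (dirderiv z ^^ m) f y / fact m * t ^ m)
       + (dirderiv z ^^ n) f (y + s *\<^sub>R z) / fact n * t ^ n"
proof -
  define d where "d m s = (dirderiv z ^^ m) f (y + s *\<^sub>R z)" for m s
  have "(d m has_real_derivative d (Suc m) s) (at s)" for m s
  proof -
    let ?g = "(dirderiv z ^^ m) f"
    have g: "(?g has_derivative (\<lambda>z. dirderiv z ?g x)) (at x)" for x
      by (intro smooth_fun_has_derivative smooth_fun_funpow assms)
    have "((\<lambda>s. y + s *\<^sub>R z) has_derivative (\<lambda>s. s *\<^sub>R z)) (at s)"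
      by (auto intro!: derivative_eq_intros)
    from has_derivative_compose[OF this g]
    have "(d m has_derivative (\<lambda>h. dirderiv (h *\<^sub>R z) ?g (y + s *\<^sub>R z))) (at s)"
      by (simp add: d_def[abs_def])
    moreover have "dirderiv (h *\<^sub>R z) ?g (y + s *\<^sub>R z) = d (Suc m) s * h" for h
      using linear_cmul[OF has_derivative_linear[OF g]] by (simp add: d_def)
    ultimately show ?thesis
      by (simp add: has_field_derivative_def)
  qed
  then obtain s where "\<bar>s\<bar> \<le> \<bar>t\<bar>" "d 0 t = (\<Sum>m<n. d m 0 / fact m * t ^ m) + d n s / fact n * t ^ n"
    using Maclaurin_all_le_objl[of d "d 0" t n] by blast
  then show ?thesis
    using that by (simp add: d_def)
qed

text \<open>Here \<open>K\<close> may depend on \<open>z\<close>, but not on \<open>t\<close> or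
  \<open>y\<close>. The indicator makes the bound integrable in \<open>y\<close>, so that the
  expansion can be integrated against a bounded function.\<close>

lemma taylor_bound_compact_support:
  assumes f: "smooth_fun f" and out: "\<And>x. x \<notin> cball c r \<Longrightarrow> f x = 0"
  obtains K where "K \<ge> 0"
    "\<And>t y. \<bar>t\<bar> \<le> 1 \<Longrightarrow> \<bar>f (y + t *\<^sub>R z) - (\<Sum>m<n. (dirderiv z ^^ m) f y / fact m * t ^ m)\<bar>
       \<le> K * \<bar>t\<bar> ^ n * indicator (cball c (r + norm z)) y"
proof -
  let ?g = "(dirderiv z ^^ n) f"
  have g0: "?g x = 0" if "x \<notin> cball c r" for x
    using funpow_dirderiv_outside[of "cball c r"] out that by simp
  have "\<exists>K\<ge>0. \<forall>x. \<bar>?g x\<bar> \<le> K"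
    by (rule compact_support_bounded[OF smooth_fun_continuous_on[OF smooth_fun_funpow[OF f]]
          compact_cball[of c r] g0]) blast+
  then obtain K where K: "K \<ge> 0" "\<And>x. \<bar>?g x\<bar> \<le> K"
    by blast
  have "\<bar>f (y + t *\<^sub>R z) - (\<Sum>m<n. (dirderiv z ^^ m) f y / fact m * t ^ m)\<bar>
       \<le> K * \<bar>t\<bar> ^ n * indicator (cball c (r + norm z)) y" if t: "\<bar>t\<bar> \<le> 1" for t y
  proof -
    obtain s where s: "\<bar>s\<bar> \<le> \<bar>t\<bar>"
      and "f (y + t *\<^sub>R z) = (\<Sum>m<n. (dirderiv z ^^ m) f y / fact m * t ^ m)
        + ?g (y + s *\<^sub>R z) / fact n * t ^ n"
      by (rule smooth_fun_taylor[OF f])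
    then have eq: "f (y + t *\<^sub>R z) - (\<Sum>m<n. (dirderiv z ^^ m) f y / fact m * t ^ m) =
        ?g (y + s *\<^sub>R z) / fact n * t ^ n"
      by simp
    show ?thesis
    proof (cases "y \<in> cball c (r + norm z)")
      case True
      \<comment> \<open>The factorial is at least 1 and is dropped.\<close>
      have "\<bar>?g (y + s *\<^sub>R z)\<bar> / fact n \<le> K / 1"
        using K by (intro frac_le) auto
      then have "\<bar>?g (y + s *\<^sub>R z)\<bar> / fact n * \<bar>t\<bar> ^ n \<le> K * \<bar>t\<bar> ^ n"
        by (intro mult_right_mono) auto
      with True show ?thesis
        unfolding eq by (simp add: abs_mult power_abs)
    next
      case False
      \<comment> \<open>The intermediate point is within \<open>norm z\<close> of \<open>y\<close>,
        hence still outside \<open>cball c r\<close>, where the remainder vanishes.\<close>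
      have "norm (s *\<^sub>R z) \<le> norm z"
        using s t by (simp add: mult_left_le_one_le)
      moreover have "dist c y \<le> dist c (y + s *\<^sub>R z) + norm (s *\<^sub>R z)"
        by (metis add_diff_cancel_left' dist_commute dist_norm dist_triangle)
      ultimately have "y + s *\<^sub>R z \<notin> cball c r"
        using False by auto
      with False show ?thesis
        unfolding eq by (simp add: g0)
    qed
  qed
  with K show ?thesis using that by blast
qed

text \<open>Now \<open>K\<close> is uniform over all directions in the unit ball. The factor
  \<open>(norm z)\<^sup>2\<close> is what the integrability condition on the measure controls near
  0.\<close>

lemma second_order_bound_compact_support:
  assumes f: "smooth_fun f" and out: "\<And>x. x \<notin> cball c r \<Longrightarrow> f x = 0"
  obtains K where "K \<ge> 0"
    "\<And>z y. norm z \<le> 1 \<Longrightarrow> \<bar>f (y + z) - f y - dirderiv z f y\<bar>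
       \<le> K * (norm z)\<^sup>2 * indicator (cball c (r + 1)) y"
proof -
  have out2: "dirderiv a (dirderiv b f) x = 0" if "x \<notin> cball c r" for a b x
    using dirderiv_outside[of "cball c r" "dirderiv b f"] dirderiv_outside[of "cball c r" f] out that
    by simp
  have "\<exists>K\<ge>0. \<forall>x. \<bar>dirderiv a (dirderiv b f) x\<bar> \<le> K" for a b
    by (rule compact_support_bounded[OF smooth_fun_continuous_on[OF
            smooth_fun_dirderiv[OF smooth_fun_dirderiv[OF f]]] compact_cball[of c r] out2]) blast+
  then obtain B where B: "\<And>a b. B a b \<ge> 0" "\<And>a b x. \<bar>dirderiv a (dirderiv b f) x\<bar> \<le> B a b"
    by metis
  \<comment> \<open>Each coordinate of \<open>z\<close> is at most \<open>norm z\<close>, so summing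
    the bounds of all second partials bounds the quadratic form by
    \<open>K * (norm z)\<^sup>2\<close>.\<close>
  define K where "K = (\<Sum>a\<in>Basis. \<Sum>b\<in>Basis. B a b)"
  have K0: "K \<ge> 0"
    using B by (auto simp: K_def intro!: sum_nonneg)
  have K: "\<bar>dirderiv z (dirderiv z f) x\<bar> \<le> K * (norm z)\<^sup>2" for z x
  proof -
    have "\<bar>dirderiv z (dirderiv z f) x\<bar>
      \<le> (\<Sum>a\<in>Basis. \<Sum>b\<in>Basis. \<bar>(z \<bullet> a) * (z \<bullet> b) * dirderiv a (dirderiv b f) x\<bar>)"
      unfolding dirderiv_basis2[OF f]
      by (rule order_trans[OF sum_abs]) (intro sum_mono sum_abs)
    also have "\<dots> \<le> (\<Sum>a\<in>Basis. \<Sum>b\<in>Basis. (norm z * norm z) * B a b)"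
      unfolding abs_mult using B by (intro sum_mono mult_mono) (auto simp: Basis_le_norm)
    also have "\<dots> = K * (norm z)\<^sup>2"
      by (simp add: K_def sum_distrib_left sum_distrib_right power2_eq_square mult_ac)
    finally show ?thesis .
  qed
  have "\<bar>f (y + z) - f y - dirderiv z f y\<bar> \<le> K * (norm z)\<^sup>2 * indicator (cball c (r + 1)) y"
    if z: "norm z \<le> 1" for z y
  proof -
    obtain s where s: "\<bar>s\<bar> \<le> \<bar>1\<bar>"
      and "f (y + 1 *\<^sub>R z) = (\<Sum>m<2. (dirderiv z ^^ m) f y / fact m * 1 ^ m)
        + (dirderiv z ^^ 2) f (y + s *\<^sub>R z) / fact 2 * 1 ^ 2"
      by (rule smooth_fun_taylor[OF f, of 1 y z 2])
    then have eq: "f (y + z) - f y - dirderiv z f y = dirderiv z (dirderiv z f) (y + s *\<^sub>R z) / 2"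
      by (simp add: numeral_2_eq_2)
    show ?thesis
    proof (cases "y \<in> cball c (r + 1)")
      case True
      then show ?thesis
        using K[of z "y + s *\<^sub>R z"] unfolding eq by simp
    next
      case False
      have "norm (s *\<^sub>R z) \<le> 1"
        using s z by (simp add: mult_le_one)
      moreover have "dist c y \<le> dist c (y + s *\<^sub>R z) + norm (s *\<^sub>R z)"
        by (metis add_diff_cancel_left' dist_commute dist_norm dist_triangle)
      ultimately have "y + s *\<^sub>R z \<notin> cball c r"
        using False by auto
      with False show ?thesis
        unfolding eq by (simp add: out2)
    qed
  qed
  with K0 show ?thesis using that by blast
qed

section \<open>Mollification\<close>

lemma integrable_compact_support:
  fixes g :: "'a::euclidean_space \<Rightarrow> real"
  assumes "continuous_on UNIV g" "compact S" "\<And>x. x \<notin> S \<Longrightarrow> g x = 0"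
  shows "integrable lborel g"
proof -
  have "integrable lborel (\<lambda>x. indicator S x *\<^sub>R g x)"
    by (rule borel_integrable_compact[OF assms(2) continuous_on_subset[OF assms(1) subset_UNIV]])
  moreover have "(\<lambda>x. indicator S x *\<^sub>R g x) = g"
    using assms(3) by (intro ext) (auto simp: indicator_def)
  ultimately show ?thesis by simp
qed

lemma integral_cball_bound:
  fixes h :: "'a::euclidean_space \<Rightarrow> real"
  assumes "integrable lborel h" "\<And>y. \<bar>h y\<bar> \<le> A * indicator (cball c R) y"
  shows "\<bar>\<integral>y. h y \<partial>lborel\<bar> \<le> A * measure lborel (cball c R)"
proof -
  have "\<bar>\<integral>y. h y \<partial>lborel\<bar> \<le> (\<integral>y. \<bar>h y\<bar> \<partial>lborel)"
    by (rule integral_abs_bound)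
  also have "\<dots> \<le> (\<integral>y. A * indicator (cball c R) y \<partial>lborel)"
    using assms by (intro integral_mono)
       (auto intro!: integrable_mult_right integrable_real_indicator simp: emeasure_lborel_cball_finite[unfolded infinity_ennreal_def])
  finally show ?thesis by simp
qed

section \<open>Functions vanishing at infinity and their mollifications\<close>

lemma C0_fun_bounded:
  fixes v :: "'a::euclidean_space \<Rightarrow> real"
  assumes "C0_fun v"
  obtains M where "M \<ge> 0" "\<And>x. \<bar>v x\<bar> \<le> M"
proof -
  have cont: "continuous_on UNIV v" and lim: "(v \<longlongrightarrow> 0) at_infinity"
    using assms by (auto simp: C0_fun_def)
  obtain R where R: "\<And>x. norm x \<ge> R \<Longrightarrow> \<bar>v x\<bar> < 1"
    using tendstoD[OF lim, of 1] by (auto simp: eventually_at_infinity dist_norm)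
  have "bounded (v ` cball 0 R)"
    by (intro compact_imp_bounded compact_continuous_image continuous_on_subset[OF cont]) auto
  then obtain K where K: "\<forall>x\<in>cball 0 R. \<bar>v x\<bar> \<le> K"
    unfolding bounded_iff by auto
  have "\<bar>v x\<bar> \<le> max K 1" for x
    using R[of x] K[THEN bspec, of x] by (cases "norm x \<le> R") auto
  then show ?thesis using that[of "max K 1"] by auto
qed

text \<open>Outside a large ball the values stay below \<open>w a\<close>, so \<open>a\<close> lies
  in the ball and the maximum over this compact ball is global.\<close>

lemma C0_fun_attains_max:
  fixes w :: "'a::euclidean_space \<Rightarrow> real"
  assumes "C0_fun w" "w a > 0"
  obtains m where "\<And>x. w x \<le> w m" "w m > 0"
proof -
  have cont: "continuous_on UNIV w" and lim: "(w \<longlongrightarrow> 0) at_infinity"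
    using assms by (auto simp: C0_fun_def)
  obtain R where R: "\<And>x. norm x \<ge> R \<Longrightarrow> \<bar>w x\<bar> < w a"
    using tendstoD[OF lim, of "w a"] assms(2) by (auto simp: eventually_at_infinity dist_norm)
  have a: "a \<in> cball 0 R"
    by (rule ccontr) (use R[of a] in auto)
  have "\<exists>m\<in>cball 0 R. \<forall>x\<in>cball 0 R. w x \<le> w m"
    using a norm_ge_zero[of a]
    by (intro continuous_attains_sup continuous_on_subset[OF cont]) (auto simp del: norm_ge_zero)
  then obtain m where m: "\<And>x. x \<in> cball 0 R \<Longrightarrow> w x \<le> w m"
    by blast
  have "w x \<le> w m" for x
    using R[of x] m[of x] m[OF a] by (cases "norm x \<le> R") auto
  with m[OF a] assms(2) that show ?thesis by (meson less_le_trans)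
qed

text \<open>The unnormalised convolution of \<open>v\<close> with \<open>bump r 0\<close>, written
  with the bump centred at \<open>c\<close>: this bump is a test function, so the weak equation can
  be tested with it directly.\<close>

definition mollify :: "('a::euclidean_space \<Rightarrow> real) \<Rightarrow> real \<Rightarrow> 'a \<Rightarrow> real" where
  "mollify v r c = (\<integral>y. v y * bump r c y \<partial>lborel)"

text \<open>Moves the dependence on \<open>c\<close> from the bump to \<open>v\<close>, so that
  continuity and decay of \<open>v\<close> can be used under the integral.\<close>

lemma mollify_translate:
  assumes "continuous_on UNIV v"
  shows "mollify v r c = (\<integral>y. v (c + y) * bump r 0 y \<partial>lborel)"
proof -
  have [measurable]: "v \<in> borel_measurable borel" "bump r c \<in> borel_measurable borel"
    by (auto intro!: borel_measurable_continuous_onI assms smooth_fun_continuous_on smooth_bump)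
  have bump: "bump r c (c + y) = bump r 0 y" for y
    by (simp add: bump_def)
  have "mollify v r c = (\<integral>y. v y * bump r c y \<partial>(distr lborel borel ((+) c)))"
    unfolding mollify_def lborel_distr_plus ..
  also have "\<dots> = (\<integral>y. v (c + y) * bump r c (c + y) \<partial>lborel)"
    by (rule integral_distr) auto
  finally show ?thesis
    unfolding bump .
qed

lemma integrable_mult_dirderiv_bump:
  assumes "continuous_on UNIV v" "r \<ge> 0"
  shows "integrable lborel (\<lambda>y. v y * (dirderiv z ^^ n) (bump r c) y)"
proof (rule integrable_compact_support)
  show "continuous_on UNIV (\<lambda>y. v y * (dirderiv z ^^ n) (bump r c) y)"
    by (intro continuous_on_mult assms smooth_fun_continuous_on smooth_fun_funpow smooth_bump)
  show "v y * (dirderiv z ^^ n) (bump r c) y = 0" if "y \<notin> cball c r" for y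
    using funpow_dirderiv_outside[of "cball c r" "bump r c", OF _ bump_outside[OF assms(2)] that] by simp
qed simp

lemma integrable_mult_bump:
  assumes "continuous_on UNIV v" "r \<ge> 0"
  shows "integrable lborel (\<lambda>y. v y * bump r c y)"
  using integrable_mult_dirderiv_bump[OF assms, where n = 0 and c = c] by simp

text \<open>The bump is expanded under the integral, so all derivatives fall on it and
  \<open>v\<close> need only be continuous and bounded. Moving the centre to \<open>c - t z\<close>
  shifts the argument by \<open>+ t z\<close>, hence no alternating signs.\<close>

lemma mollify_taylor:
  assumes v: "continuous_on UNIV v" "\<And>x. \<bar>v x\<bar> \<le> M" and r: "r \<ge> 0"
  obtains K where "\<And>t. \<bar>t\<bar> \<le> 1 \<Longrightarrow>
    \<bar>mollify v r (c - t *\<^sub>R z)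
      - (\<Sum>m<n. (\<integral>y. v y * (dirderiv z ^^ m) (bump r c) y \<partial>lborel) / fact m * t ^ m)\<bar> \<le> K * \<bar>t\<bar> ^ n"
proof -
  define R where "R t y = bump r c (y + t *\<^sub>R z)
    - (\<Sum>m<n. (dirderiv z ^^ m) (bump r c) y / fact m * t ^ m)" for t y
  have "\<exists>K\<ge>0. \<forall>t y. \<bar>t\<bar> \<le> 1 \<longrightarrow>
      \<bar>R t y\<bar> \<le> K * \<bar>t\<bar> ^ n * indicator (cball c (r + norm z)) y"
    unfolding R_def
    by (rule taylor_bound_compact_support[OF smooth_bump bump_outside[OF r], where z = z and n = n and c = c]) blast+
  then obtain K where K: "K \<ge> 0"
    "\<And>t y. \<bar>t\<bar> \<le> 1 \<Longrightarrow> \<bar>R t y\<bar> \<le> K * \<bar>t\<bar> ^ n * indicator (cball c (r + norm z)) y"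
    by blast
  show ?thesis
  proof (rule that[of "M * K * measure lborel (cball c (r + norm z))"])
    fix t :: real assume t: "\<bar>t\<bar> \<le> 1"
    let ?I = "\<lambda>m. \<integral>y. v y * (dirderiv z ^^ m) (bump r c) y \<partial>lborel"
    have eq: "v y * R t y = v y * bump r (c - t *\<^sub>R z) y
      - (\<Sum>m<n. v y * (dirderiv z ^^ m) (bump r c) y * (t ^ m / fact m))" for y
      by (simp add: R_def bump_translate right_diff_distrib sum_distrib_left mult_ac)
    have int: "integrable lborel (\<lambda>y. v y * R t y)"
      unfolding eq by (intro Bochner_Integration.integrable_diff Bochner_Integration.integrable_sum
          integrable_mult_left integrable_mult_dirderiv_bump integrable_mult_bump v r)
    have "(\<integral>y. v y * R t y \<partial>lborel) = mollify v r (c - t *\<^sub>R z) - (\<Sum>m<n. ?I m / fact m * t ^ m)"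
    proof -
      have "(\<integral>y. (\<Sum>m<n. v y * (dirderiv z ^^ m) (bump r c) y * (t ^ m / fact m)) \<partial>lborel)
          = (\<Sum>m<n. ?I m / fact m * t ^ m)"
        by (subst Bochner_Integration.integral_sum)
           (auto intro!: integrable_mult_left integrable_mult_dirderiv_bump v r
              simp del: times_divide_eq_right, simp add: mult_ac)
      then show ?thesis
        unfolding eq mollify_def
        by (subst Bochner_Integration.integral_diff)
           (auto intro!: integrable_mult_bump integrable_mult_dirderiv_bump v r
              Bochner_Integration.integrable_sum integrable_mult_left simp del: times_divide_eq_right)
    qed
    moreover have "\<bar>v y * R t y\<bar> \<le> M * K * \<bar>t\<bar> ^ n * indicator (cball c (r + norm z)) y" for y
      using mult_mono[OF v(2)[of y] K(2)[OF t, of y]] order_trans[OF abs_ge_zero v(2)[of y]]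
      by (simp add: abs_mult mult.assoc)
    ultimately show "\<bar>mollify v r (c - t *\<^sub>R z) - (\<Sum>m<n. ?I m / fact m * t ^ m)\<bar>
      \<le> M * K * measure lborel (cball c (r + norm z)) * \<bar>t\<bar> ^ n"
      using integral_cball_bound[OF int, of "M * K * \<bar>t\<bar> ^ n" c "r + norm z"] by (simp add: mult_ac)
  qed
qed

text \<open>Continuity is dominated convergence with majorant \<open>M * bump r 0\<close>. For
  decay, only values of \<open>v\<close> within distance \<open>r\<close> of \<open>c\<close> enter,
  and these are small once \<open>norm c \<ge> R + r\<close>.\<close>

lemma mollify_C0:
  fixes v :: "'a::euclidean_space \<Rightarrow> real"
  assumes "C0_fun v" "r \<ge> 0"
  shows "C0_fun (mollify v r)"
proof -
  have cont: "continuous_on UNIV v" and lim: "(v \<longlongrightarrow> 0) at_infinity"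
    using assms by (auto simp: C0_fun_def)
  obtain M where M: "\<And>x. \<bar>v x\<bar> \<le> M"
    using C0_fun_bounded[OF assms(1)] by blast
  have [measurable]: "v \<in> borel_measurable borel" "bump r 0 \<in> borel_measurable borel"
    by (auto intro!: borel_measurable_continuous_onI cont smooth_fun_continuous_on smooth_bump)
  have bump: "integrable lborel (bump r 0)"
    using integrable_mult_bump[of "\<lambda>_. 1" r 0] assms by simp
  have "isCont (mollify v r) c" for c
    unfolding continuous_at_sequentially comp_def mollify_translate[OF cont]
  proof (intro allI impI integral_dominated_convergence[where w="\<lambda>y. M * bump r 0 y"])
    fix s assume s: "s \<longlonglongrightarrow> c"
    have "(\<lambda>i. v (s i + y)) \<longlonglongrightarrow> v (c + y)" for y
      by (rule continuous_on_tendsto_compose[OF cont]) (auto intro!: tendsto_intros s)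
    then show "AE y in lborel. (\<lambda>i. v (s i + y) * bump r 0 y) \<longlonglongrightarrow> v (c + y) * bump r 0 y"
      by (intro AE_I2 tendsto_mult tendsto_const)
  qed (use bump M bump_nonneg[of r 0] in \<open>auto simp: abs_mult bump_nonneg intro!: AE_I2 mult_right_mono\<close>)
  moreover have "(mollify v r \<longlongrightarrow> 0) at_infinity"
  proof (rule tendstoI)
    fix e :: real assume e: "e > 0"
    define J where "J = (\<integral>y. bump r (0::'a) y \<partial>lborel)"
    have J: "J \<ge> 0"
      unfolding J_def by (simp add: bump_nonneg)
    \<comment> \<open>Dividing by \<open>J + 1\<close> gives \<open>d > 0\<close> and the strict
      bound \<open>d * J < e\<close> from \<open>J \<ge> 0\<close> alone.\<close>
    define d where "d = e / (J + 1)"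
    have d: "d > 0" "d * J < e"
      using e J by (auto simp: d_def field_simps)
    obtain R where R: "\<And>x. norm x \<ge> R \<Longrightarrow> \<bar>v x\<bar> < d"
      using tendstoD[OF lim d(1)] by (auto simp: eventually_at_infinity dist_norm)
    have "\<bar>mollify v r c\<bar> < e" if c: "norm c \<ge> R + r" for c
    proof -
      have le: "\<bar>v (c + y) * bump r 0 y\<bar> \<le> d * bump r 0 y" for y
      proof (cases "y \<in> cball 0 r")
        case True
        have "norm c \<le> norm (c + y) + norm y"
          by (metis add_diff_cancel_right' norm_triangle_ineq4)
        then have "\<bar>v (c + y)\<bar> \<le> d"
          using R[of "c + y"] True c by auto
        then show ?thesis
          using bump_nonneg[of r 0 y] by (simp add: abs_mult mult_right_mono)
      qed (simp add: bump_outside assms)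
      have "\<bar>mollify v r c\<bar> \<le> (\<integral>y. \<bar>v (c + y) * bump r 0 y\<bar> \<partial>lborel)"
        unfolding mollify_translate[OF cont] by (rule integral_abs_bound)
      also have "\<dots> \<le> (\<integral>y. d * bump r (0::'a) y \<partial>lborel)"
      proof (rule integral_mono)
        show "integrable lborel (\<lambda>y. \<bar>v (c + y) * bump r 0 y\<bar>)"
          by (rule Bochner_Integration.integrable_bound[of _ "\<lambda>y. d * bump r 0 y"])
             (use bump le d in \<open>auto simp: abs_mult bump_nonneg intro!: AE_I2\<close>)
      qed (use bump le in auto)
      also have "\<dots> = d * J"
        by (simp add: J_def)
      finally show ?thesis using d by simp
    qed
    then show "\<forall>\<^sub>F c in at_infinity. dist (mollify v r c) 0 < e"
      by (auto simp: eventually_at_infinity dist_norm)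
  qed
  ultimately show ?thesis
    by (simp add: C0_fun_def continuous_at_imp_continuous_on)
qed

text \<open>On a small ball around \<open>c\<close> the function \<open>v\<close> is positive, so
  the integrand is nonnegative everywhere. A zero integral would force it to vanish almost
  everywhere, and by continuity also at \<open>c\<close>.\<close>

lemma mollify_pos:
  fixes v :: "'a::euclidean_space \<Rightarrow> real"
  assumes cont: "continuous_on UNIV v" and "v c > 0"
  obtains r where "r > 0" "mollify v r c > 0"
proof -
  have "open {x. v x > 0}"
    using open_Collect_less[of "\<lambda>_. 0" v] cont by simp
  then obtain r where r: "r > 0" "cball c r \<subseteq> {x. v x > 0}"
    using assms(2) open_contains_cball by blast
  have nonneg: "v y * bump r c y \<ge> 0" for y
    using r bump_outside[of r y c] bump_nonneg[of r c y] by (cases "y \<in> cball c r") auto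
  have gc: "continuous_on UNIV (\<lambda>y. v y * bump r c y)"
    by (intro continuous_on_mult cont smooth_fun_continuous_on smooth_bump)
  have "mollify v r c \<noteq> 0"
  proof
    assume "mollify v r c = 0"
    then have "AE y in lborel. v y * bump r c y = 0"
      unfolding mollify_def using integral_nonneg_eq_0_iff_AE[OF integrable_mult_bump[OF cont]] nonneg r
      by auto
    \<comment> \<open>A closed set of full Lebesgue measure contains every point; the passage to the
      completion puts the statement in that form.\<close>
    then have "AE y in lebesgue. y \<in> {y. v y * bump r c y = 0}"
      by (auto dest: AE_completion)
    moreover have "closed {y. v y * bump r c y = 0}"
      by (rule closed_Collect_eq) (auto intro: gc)
    ultimately have "v c * bump r c c = 0"
      using mem_closed_if_AE_lebesgue by blast
    then show False
      using assms(2) bump_center_pos[OF r(1), of c] by simp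
  qed
  moreover have "mollify v r c \<ge> 0"
    unfolding mollify_def by (simp add: nonneg)
  ultimately show ?thesis using that r by force
qed

text \<open>No differentiability of \<open>h\<close> is assumed: a quadratic expansion with cubic
  error suffices. Comparing \<open>t\<close> with \<open>-t\<close> separates the two
  coefficients.\<close>

lemma local_max_second_order:
  fixes h :: "real \<Rightarrow> real"
  assumes h: "\<And>t. \<bar>t\<bar> \<le> 1 \<Longrightarrow> \<bar>h t - (a0 + a1 * t + a2 * t\<^sup>2)\<bar> \<le> K * \<bar>t\<bar> ^ 3"
    and "d > 0" and max: "\<And>t. \<bar>t\<bar> \<le> d \<Longrightarrow> h t \<le> a0"
  shows "a1 = 0" "a2 \<le> 0"
proof -
  have small: "a \<le> 0" if "\<And>t. 0 < t \<Longrightarrow> t \<le> min 1 d \<Longrightarrow> a \<le> C * t" for a C :: real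
  proof (rule tendsto_lowerbound)
    show "((\<lambda>t. C * t) \<longlongrightarrow> 0) (at_right 0)"
      by (auto intro!: tendsto_eq_intros)
    have "\<forall>\<^sub>F t in at_right 0. t \<in> {0<..<min 1 d}"
      using \<open>d > 0\<close> by (intro eventually_at_right_real) auto
    then show "\<forall>\<^sub>F t in at_right 0. a \<le> C * t"
      by eventually_elim (use that in auto)
  qed simp
  have pos: "a1 * t + a2 * t\<^sup>2 \<le> K * t ^ 3" "- a1 * t + a2 * t\<^sup>2 \<le> K * t ^ 3"
    if "0 < t" "t \<le> min 1 d" for t
    using h[of t] h[of "-t"] max[of t] max[of "-t"] that by auto
  show "a2 \<le> 0"
  proof (rule small[of _ K])
    fix t :: real assume t: "0 < t" "t \<le> min 1 d"
    \<comment> \<open>Adding the two inequalities cancels the linear term.\<close>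
    have "a2 * t\<^sup>2 \<le> (K * t) * t\<^sup>2"
      using pos[OF t] by (simp add: power3_eq_cube power2_eq_square)
    then show "a2 \<le> K * t"
      using t by (simp only: mult_le_cancel_right_pos zero_less_power)
  qed
  have "\<bar>a1\<bar> \<le> 0"
  proof (rule small[of _ "\<bar>K\<bar> + \<bar>a2\<bar>"])
    fix t :: real assume t: "0 < t" "t \<le> min 1 d"
    have "\<bar>a1\<bar> * t \<le> (K * t - a2) * t * t"
      using pos[OF t] t by (auto simp: abs_if algebra_simps power3_eq_cube power2_eq_square)
    then have "\<bar>a1\<bar> \<le> (K * t - a2) * t"
      using t by simp
    \<comment> \<open>By \<open>t \<le> 1\<close> the factor is bounded by a constant, as
      \<open>small\<close> requires.\<close>
    also have "K * t - a2 \<le> \<bar>K\<bar> * 1 + \<bar>a2\<bar>"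
      using t mult_mono[of K "\<bar>K\<bar>" t 1] abs_ge_self[of K] by auto
    finally show "\<bar>a1\<bar> \<le> (\<bar>K\<bar> + \<bar>a2\<bar>) * t"
      using t by (simp add: mult_right_mono)
  qed
  then show "a1 = 0" by simp
qed

section \<open>The nonlocal part of the mollified equation\<close>

text \<open>The compact shells \<open>1/(n+1) \<le> norm z \<le> n\<close> have finite measure and
  exhaust everything except 0; the null set \<open>{0}\<close> completes the cover.\<close>

lemma sigma_finite_off_zero:
  fixes \<mu> :: "'a::euclidean_space measure"
  assumes sets: "sets \<mu> = sets borel" and no_zero: "emeasure \<mu> {0} = 0"
    and radon: "\<And>K. compact K \<Longrightarrow> 0 \<notin> K \<Longrightarrow> emeasure \<mu> K < \<infinity>"
  shows "sigma_finite_measure \<mu>"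
proof
  define S :: "nat \<Rightarrow> 'a set" where "S n = cball 0 (real n) - ball 0 (inverse (real (Suc n)))" for n
  have comp: "compact (S n)" "0 \<notin> S n" for n
    by (auto simp: S_def intro: compact_diff)
  have cover: "\<exists>n. z \<in> S n" if "z \<noteq> 0" for z
  proof -
    obtain n where n: "inverse (real (Suc n)) < norm z"
      using reals_Archimedean[of "norm z"] \<open>z \<noteq> 0\<close> by (metis zero_less_norm_iff)
    obtain m where m: "norm z \<le> real m"
      using real_arch_simple by blast
    have "inverse (real (Suc (max n m))) \<le> inverse (real (Suc n))"
      by (rule le_imp_inverse_le) auto
    with n have "inverse (real (Suc (max n m))) \<le> norm z"
      by linarith
    with m have "z \<in> S (max n m)"
      by (simp add: S_def del: of_nat_Suc)
    then show ?thesis ..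
  qed
  show "\<exists>A. countable A \<and> A \<subseteq> sets \<mu> \<and> \<Union> A = space \<mu> \<and> (\<forall>a\<in>A. emeasure \<mu> a \<noteq> \<infinity>)"
  proof (intro exI[of _ "insert {0} (range S)"] conjI)
    show "insert {0} (range S) \<subseteq> sets \<mu>"
      using comp(1) by (auto simp: sets borel_compact)
    show "\<Union> (insert {0} (range S)) = space \<mu>"
      using cover sets_eq_imp_space_eq[OF sets] by (auto simp: space_borel)
    show "\<forall>a\<in>insert {0} (range S). emeasure \<mu> a \<noteq> \<infinity>"
      using radon[OF comp] no_zero by (auto simp: less_top[symmetric])
  qed simp
qed

lemma loc_part:
  fixes v :: "'a::euclidean_space \<Rightarrow> real"
  assumes v: "continuous_on UNIV v" and r: "r \<ge> 0"
  shows "integrable lborel (\<lambda>y. v y * loc_op P \<sigma> (bump r c) y)"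
    and "(\<integral>y. v y * loc_op P \<sigma> (bump r c) y \<partial>lborel) =
      (\<Sum>i<P. \<integral>y. v y * (dirderiv (\<sigma> i) ^^ 2) (bump r c) y \<partial>lborel)"
proof -
  have eq: "v y * loc_op P \<sigma> (bump r c) y = (\<Sum>i<P. v y * (dirderiv (\<sigma> i) ^^ 2) (bump r c) y)" for y
    by (simp add: loc_op_def sum_distrib_left numeral_2_eq_2)
  note int = integrable_mult_dirderiv_bump[OF v r, where n = 2 and c = c]
  show "integrable lborel (\<lambda>y. v y * loc_op P \<sigma> (bump r c) y)"
    unfolding eq by (intro Bochner_Integration.integrable_sum int)
  show "(\<integral>y. v y * loc_op P \<sigma> (bump r c) y \<partial>lborel) =
      (\<Sum>i<P. \<integral>y. v y * (dirderiv (\<sigma> i) ^^ 2) (bump r c) y \<partial>lborel)"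
    unfolding eq by (intro Bochner_Integration.integral_sum int)
qed

section \<open>Integrability and Fubini for the Levy integrand\<close>

locale levy_measure =
  fixes \<mu> :: "'a::euclidean_space measure"
  assumes sets_mu: "sets \<mu> = sets borel"
    and no_zero: "emeasure \<mu> {0} = 0"
    and radon: "\<And>K. compact K \<Longrightarrow> 0 \<notin> K \<Longrightarrow> emeasure \<mu> K < \<infinity>"
    and levy: "(\<integral>\<^sup>+ z. ennreal (min ((norm z)\<^sup>2) 1) \<partial>\<mu>) < \<infinity>"
begin

lemma space_mu: "space \<mu> = UNIV"
  using sets_eq_imp_space_eq[OF sets_mu] by simp

lemma measurable_mu: "borel_measurable \<mu> = borel_measurable borel"
  by (rule measurable_cong_sets) (simp_all add: sets_mu)

text \<open>The indicator replaces the set integral, so that the integrand is a function of the pair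
  \<open>(z, y)\<close> on a product space.\<close>

definition levy_integrand :: "('a \<Rightarrow> real) \<Rightarrow> 'a \<Rightarrow> 'a \<Rightarrow> real" where
  "levy_integrand f z y =
    indicator (UNIV - {0}) z * (f (y + z) - f y - (if norm z \<le> 1 then dirderiv z f y else 0))"

lemma nonloc_op_eq: "nonloc_op \<mu> f y = (\<integral>z. levy_integrand f z y \<partial>\<mu>)"
  by (simp add: nonloc_op_def set_lebesgue_integral_def levy_integrand_def)

text \<open>Expanding the gradient term in the basis separates \<open>z\<close> from
  \<open>y\<close>; only continuity of \<open>f\<close> and of its first partials is then
  involved.\<close>

lemma levy_integrand_measurable:
  assumes "smooth_fun f"
  shows "(\<lambda>(z, y). levy_integrand f z y) \<in> borel_measurable (\<mu> \<Otimes>\<^sub>M lborel)"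
proof -
  have [measurable]: "f \<in> borel_measurable borel" "\<And>b. dirderiv b f \<in> borel_measurable borel"
    by (auto intro!: borel_measurable_continuous_onI smooth_fun_continuous_on smooth_fun_dirderiv assms)
  have "(\<lambda>(z, y). indicator (UNIV - {0}) z * (f (y + z) - f y -
      (if norm z \<le> 1 then \<Sum>b\<in>Basis. (z \<bullet> b) * dirderiv b f y else 0)))
    \<in> borel_measurable (borel \<Otimes>\<^sub>M (borel :: 'a measure))"
    by measurable
  moreover have "levy_integrand f z y = indicator (UNIV - {0}) z * (f (y + z) - f y -
      (if norm z \<le> 1 then \<Sum>b\<in>Basis. (z \<bullet> b) * dirderiv b f y else 0))" for z y
    unfolding levy_integrand_def by (subst dirderiv_basis[OF assms, of z y]) (rule refl)
  ultimately show ?thesis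
    by (simp only: measurable_cong_sets[OF sets_pair_measure_cong[OF sets_mu sets_lborel] refl])
qed

text \<open>For \<open>norm z \<le> 1\<close> the second-order bound applies. For larger jumps only
  the boundedness of the bump counts, and its support and the translated one account for the two
  indicators.\<close>

lemma levy_integrand_bound:
  assumes "r \<ge> 0"
  obtains K where "K \<ge> 0" "\<And>z y. \<bar>levy_integrand (bump r c) z y\<bar>
    \<le> K * min ((norm z)\<^sup>2) 1 * (indicator (cball c (r + 1)) y + indicator (cball (c - z) r) y)"
proof -
  have "\<exists>K\<ge>0. \<forall>z y. norm z \<le> 1 \<longrightarrow> \<bar>bump r c (y + z) - bump r c y - dirderiv z (bump r c) y\<bar>
       \<le> K * (norm z)\<^sup>2 * indicator (cball c (r + 1)) y"
    by (rule second_order_bound_compact_support[OF smooth_bump bump_outside[OF assms], where c = c]) blast+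
  then obtain K where K: "K \<ge> 0" "\<And>z y. norm z \<le> 1 \<Longrightarrow>
     \<bar>bump r c (y + z) - bump r c y - dirderiv z (bump r c) y\<bar>
       \<le> K * (norm z)\<^sup>2 * indicator (cball c (r + 1)) y"
    by blast
  have "\<exists>B\<ge>0. \<forall>x. \<bar>bump r c x\<bar> \<le> B"
    by (rule compact_support_bounded[OF smooth_fun_continuous_on[OF smooth_bump]
          compact_cball[of c r] bump_outside[OF assms]]) blast+
  then obtain B where B: "B \<ge> 0" "\<And>x. \<bar>bump r c x\<bar> \<le> B" by blast
  have "\<bar>levy_integrand (bump r c) z y\<bar>
    \<le> (K + B) * min ((norm z)\<^sup>2) 1 * (indicator (cball c (r + 1)) y + indicator (cball (c - z) r) y)"
    for z y
  proof (cases "norm z \<le> 1")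
    case True
    then have m: "min ((norm z)\<^sup>2) 1 = (norm z)\<^sup>2"
      by (simp add: power_le_one)
    have "\<bar>levy_integrand (bump r c) z y\<bar> \<le> K * (norm z)\<^sup>2 * indicator (cball c (r + 1)) y"
      using K(1) K(2)[OF True, of y] True by (auto simp: levy_integrand_def indicator_def)
    also have "\<dots> \<le> (K + B) * (norm z)\<^sup>2 *
        (indicator (cball c (r + 1)) y + indicator (cball (c - z) r) y)"
      using K(1) B(1) by (intro mult_mono) auto
    finally show ?thesis by (simp only: m)
  next
    case False
    then have m: "min ((norm z)\<^sup>2) 1 = 1"
      by (simp add: power2_eq_square min_def) (smt (verit) mult_less_cancel_left2)
    have 1: "\<bar>bump r c y\<bar> \<le> B * indicator (cball c (r + 1)) y"
      using B bump_outside[OF assms, of y c] by (cases "y \<in> cball c (r + 1)") auto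
    have 2: "\<bar>bump r c (y + z)\<bar> \<le> B * indicator (cball (c - z) r) y"
      unfolding bump_translate
      using B(2)[of "y + z"] bump_outside[OF assms, of y "c - z"]
      by (cases "y \<in> cball (c - z) r") (auto simp: bump_translate)
    have "\<bar>levy_integrand (bump r c) z y\<bar> \<le> \<bar>bump r c (y + z)\<bar> + \<bar>bump r c y\<bar>"
      using False by (auto simp: levy_integrand_def indicator_def)
    also have "\<dots> \<le> B * (indicator (cball c (r + 1)) y + indicator (cball (c - z) r) y)"
      using 1 2 by (simp add: distrib_left)
    also have "\<dots> \<le> (K + B) * (indicator (cball c (r + 1)) y + indicator (cball (c - z) r) y)"
      using K(1) by (intro mult_right_mono) auto
    finally show ?thesis by (simp add: m)
  qed
  then show ?thesis using that[of "K + B"] K(1) B(1) by auto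
qed

lemma levy_integrand_integrable:
  fixes v :: "'a \<Rightarrow> real"
  assumes v: "continuous_on UNIV v" "\<And>x. \<bar>v x\<bar> \<le> M" and r: "r \<ge> 0"
  shows "integrable (\<mu> \<Otimes>\<^sub>M lborel) (\<lambda>(z, y). v y * levy_integrand (bump r c) z y)"
proof (rule integrableI_bounded)
  have [measurable]: "v \<in> borel_measurable lborel"
    using borel_measurable_continuous_onI[OF v(1)] by simp
  have [measurable]: "(\<lambda>(z, y). levy_integrand (bump r c) z y) \<in> borel_measurable (\<mu> \<Otimes>\<^sub>M lborel)"
    by (rule levy_integrand_measurable[OF smooth_bump])
  show meas: "(\<lambda>(z, y). v y * levy_integrand (bump r c) z y) \<in> borel_measurable (\<mu> \<Otimes>\<^sub>M lborel)"
    by measurable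
  obtain K where K: "K \<ge> 0" "\<And>z y. \<bar>levy_integrand (bump r c) z y\<bar>
    \<le> K * min ((norm z)\<^sup>2) 1 * (indicator (cball c (r + 1)) y + indicator (cball (c - z) r) y)"
    by (rule levy_integrand_bound[OF r, of c]) (rule that)
  have M: "M \<ge> 0"
    using order_trans[OF abs_ge_zero v(2)] .
  \<comment> \<open>One ball in the bound is centred at \<open>c - z\<close>, but its volume does
    not depend on the centre, so \<open>V\<close> serves all \<open>z\<close>.\<close>
  define V where "V = emeasure lborel (cball c (r + 1)) + emeasure lborel (cball c r)"
  have "V < \<infinity>"
    by (simp add: V_def emeasure_lborel_cball_finite[unfolded infinity_ennreal_def])
  have bound: "(\<integral>\<^sup>+ y. ennreal (norm (v y * levy_integrand (bump r c) z y)) \<partial>lborel)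
      \<le> ennreal (M * K) * V * ennreal (min ((norm z)\<^sup>2) 1)" for z
  proof -
    let ?m = "min ((norm z)\<^sup>2) 1"
    have le: "norm (v y * levy_integrand (bump r c) z y)
      \<le> (M * K * ?m) * (indicator (cball c (r + 1)) y + indicator (cball (c - z) r) y)" for y
      using mult_mono[OF v(2)[of y] K(2)[of z y] M] by (simp add: abs_mult mult_ac)
    have "(\<integral>\<^sup>+ y. ennreal (norm (v y * levy_integrand (bump r c) z y)) \<partial>lborel)
      \<le> (\<integral>\<^sup>+ y. ennreal (M * K * ?m) *
          (indicator (cball c (r + 1)) y + indicator (cball (c - z) r) y) \<partial>lborel)"
    proof (rule nn_integral_mono)
      fix y
      have "ennreal (norm (v y * levy_integrand (bump r c) z y))
        \<le> ennreal ((M * K * ?m) * (indicator (cball c (r + 1)) y + indicator (cball (c - z) r) y))"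
        by (rule ennreal_leI[OF le])
      also have "\<dots> = ennreal (M * K * ?m) *
          (indicator (cball c (r + 1)) y + indicator (cball (c - z) r) y)"
        using M K(1) by (simp add: ennreal_mult ennreal_plus ennreal_indicator)
      finally show "ennreal (norm (v y * levy_integrand (bump r c) z y)) \<le> \<dots>" .
    qed
    also have "\<dots> = ennreal (M * K * ?m) * V"
    proof -
      have [simp]: "(indicator (cball x s) :: 'a \<Rightarrow> ennreal) \<in> borel_measurable borel" for x s
        by (intro borel_measurable_indicator borel_closed closed_cball)
      show ?thesis
        using r by (simp add: nn_integral_cmult nn_integral_add borel_measurable_add V_def emeasure_cball)
    qed
    also have "\<dots> = ennreal (M * K) * V * ennreal ?m"
      using M K(1) by (simp add: ennreal_mult mult_ac)
    finally show ?thesis .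
  qed
  have "(\<integral>\<^sup>+ x. ennreal (norm (case x of (z, y) \<Rightarrow> v y * levy_integrand (bump r c) z y)) \<partial>(\<mu> \<Otimes>\<^sub>M lborel))
    = (\<integral>\<^sup>+ z. \<integral>\<^sup>+ y. ennreal (norm (v y * levy_integrand (bump r c) z y)) \<partial>lborel \<partial>\<mu>)"
    by (subst lborel.nn_integral_fst[symmetric]) auto
  also have "\<dots> \<le> (\<integral>\<^sup>+ z. ennreal (M * K) * V * ennreal (min ((norm z)\<^sup>2) 1) \<partial>\<mu>)"
    by (intro nn_integral_mono bound)
  also have "\<dots> = ennreal (M * K) * V * (\<integral>\<^sup>+ z. ennreal (min ((norm z)\<^sup>2) 1) \<partial>\<mu>)"
    by (intro nn_integral_cmult) (simp add: measurable_mu)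
  also have "\<dots> < \<infinity>"
    using \<open>V < \<infinity>\<close> levy by (simp add: ennreal_mult_less_top)
  finally show "(\<integral>\<^sup>+ x. ennreal (norm (case x of (z, y) \<Rightarrow> v y * levy_integrand (bump r c) z y)) \<partial>(\<mu> \<Otimes>\<^sub>M lborel)) < \<infinity>" .
qed

text \<open>By Fubini the integration in \<open>y\<close> may come first. It turns each translate of
  the bump into a translate of the mollification, so the nonlocal operator acts on
  \<open>mollify v r\<close> at \<open>c\<close>, with jumps \<open>- z\<close>.\<close>

lemma nonlocal_part:
  fixes v :: "'a \<Rightarrow> real" and c :: 'a
  assumes v: "continuous_on UNIV v" "\<And>x. \<bar>v x\<bar> \<le> M" and r: "r \<ge> 0"
  defines "G \<equiv> \<lambda>z. indicator (UNIV - {0}) z * (mollify v r (c - z) - mollify v r c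
    - (if norm z \<le> 1 then \<integral>y. v y * dirderiv z (bump r c) y \<partial>lborel else 0))"
  shows "integrable lborel (\<lambda>y. v y * nonloc_op \<mu> (bump r c) y)"
    and "integrable \<mu> G"
    and "(\<integral>y. v y * nonloc_op \<mu> (bump r c) y \<partial>lborel) = (\<integral>z. G z \<partial>\<mu>)"
proof -
  interpret sigma_finite_measure \<mu>
    by (rule sigma_finite_off_zero[OF sets_mu no_zero radon])
  interpret pair_sigma_finite \<mu> "lborel :: 'a measure" ..
  note int = levy_integrand_integrable[OF v r, of c]
  have G: "(\<integral>y. v y * levy_integrand (bump r c) z y \<partial>lborel) = G z" for z
  proof -
    have i1: "integrable lborel (\<lambda>y. v y * bump r (c - z) y)" "integrable lborel (\<lambda>y. v y * bump r c y)"
      by (intro integrable_mult_bump v r)+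
    have i2: "integrable lborel (\<lambda>y. v y * (if norm z \<le> 1 then dirderiv z (bump r c) y else 0))"
      using integrable_mult_dirderiv_bump[OF v(1) r, where n = 1 and c = c and z = z]
      by (cases "norm z \<le> 1") auto
    have "v y * levy_integrand (bump r c) z y = indicator (UNIV - {0}) z *
       (v y * bump r (c - z) y - v y * bump r c y
         - v y * (if norm z \<le> 1 then dirderiv z (bump r c) y else 0))" for y
      by (simp add: levy_integrand_def bump_translate algebra_simps)
    then show ?thesis
      using i1 i2 by (simp add: G_def mollify_def)
  qed
  show "integrable lborel (\<lambda>y. v y * nonloc_op \<mu> (bump r c) y)"
    using integrable_snd[OF int] by (simp add: nonloc_op_eq)
  show "integrable \<mu> G"
    using integrable_fst[OF int] by (simp add: G)
  show "(\<integral>y. v y * nonloc_op \<mu> (bump r c) y \<partial>lborel) = (\<integral>z. G z \<partial>\<mu>)"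
    using Fubini_integral[OF int] by (simp add: nonloc_op_eq G)
qed

end

section \<open>The maximum principle\<close>

text \<open>Every nonzero point has a ball that is null after removal of 0. By the Lindelof property
  countably many of these sets already cover the complement of 0.\<close>

lemma emeasure_supp_empty:
  fixes \<mu> :: "'a::euclidean_space measure"
  assumes sets: "sets \<mu> = sets borel" and "measure_supp \<mu> = {}"
  shows "emeasure \<mu> (UNIV - {0}) = 0"
proof -
  define F where "F = {ball x e - {0} | x e. e > 0 \<and> emeasure \<mu> (ball x e - {0}) = 0}"
  have "open S" if "S \<in> F" for S
    using that by (auto simp: F_def)
  then obtain F' where F': "F' \<subseteq> F" "countable F'" "\<Union>F' = \<Union>F"
    using Lindelof by blast
  have "UNIV - {0} \<subseteq> \<Union>F"
  proof
    fix x :: 'a assume "x \<in> UNIV - {0}"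
    then obtain e where "e > 0" "emeasure \<mu> (ball x e - {0}) = 0"
      using assms(2) by (force simp: measure_supp_def)
    then have "ball x e - {0} \<in> F" "x \<in> ball x e - {0}"
      using \<open>x \<in> UNIV - {0}\<close> by (auto simp: F_def)
    then show "x \<in> \<Union>F" by blast
  qed
  moreover have "\<Union>F' \<in> null_sets \<mu>"
  proof -
    have "S \<in> null_sets \<mu>" if "S \<in> F'" for S
      using that F'(1) by (auto simp: F_def null_sets_def sets)
    then show ?thesis
      using null_sets_UN'[OF F'(2), of "\<lambda>S. S"] by simp
  qed
  ultimately have "UNIV - {0} \<in> null_sets \<mu>"
    using F'(3) null_sets_subset[of "\<Union>F'" \<mu> "UNIV - {0}"] by (simp add: sets)
  then show ?thesis by auto
qed

section \<open>Second-order conditions at a maximum of the mollification\<close>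

lemma mollify_taylor2:
  fixes v :: "'a::euclidean_space \<Rightarrow> real"
  assumes v: "continuous_on UNIV v" "\<And>x. \<bar>v x\<bar> \<le> M" and r: "r \<ge> 0"
  obtains K where "\<And>t. \<bar>t\<bar> \<le> 1 \<Longrightarrow> \<bar>mollify v r (c - t *\<^sub>R z) - (mollify v r c
      + (\<integral>y. v y * dirderiv z (bump r c) y \<partial>lborel) * t
      + (\<integral>y. v y * (dirderiv z ^^ 2) (bump r c) y \<partial>lborel) / 2 * t\<^sup>2)\<bar> \<le> K * \<bar>t\<bar> ^ 3"
proof -
  obtain K where K: "\<And>t. \<bar>t\<bar> \<le> 1 \<Longrightarrow>
    \<bar>mollify v r (c - t *\<^sub>R z)
      - (\<Sum>m<3. (\<integral>y. v y * (dirderiv z ^^ m) (bump r c) y \<partial>lborel) / fact m * t ^ m)\<bar> \<le> K * \<bar>t\<bar> ^ 3"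
    by (rule mollify_taylor[OF v r, where n = 3 and c = c and z = z]) (rule that)
  show ?thesis
    by (rule that[of K]) (use K in \<open>simp add: numeral_3_eq_3 numeral_2_eq_2 mollify_def\<close>)
qed

text \<open>The integrals are the first two derivatives at 0 of the mollification along
  \<open>c - t z\<close>. The case \<open>e = 0\<close> treats a plain maximum, \<open>e > 0\<close>
  a maximum after a quadratic perturbation.\<close>

lemma mollify_max_directional:
  fixes v :: "'a::euclidean_space \<Rightarrow> real"
  assumes v: "continuous_on UNIV v" "\<And>x. \<bar>v x\<bar> \<le> M" and r: "r \<ge> 0"
    and max: "\<And>x. x \<in> ball c d \<Longrightarrow> mollify v r x + e * (s \<bullet> x)\<^sup>2 \<le> mollify v r c + e * (s \<bullet> c)\<^sup>2"
    and d: "d > 0"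
  shows "(\<integral>y. v y * dirderiv z (bump r c) y \<partial>lborel) = 2 * e * (s \<bullet> c) * (s \<bullet> z)"
    and "(\<integral>y. v y * (dirderiv z ^^ 2) (bump r c) y \<partial>lborel) \<le> - 2 * e * (s \<bullet> z)\<^sup>2"
proof -
  let ?A = "\<integral>y. v y * dirderiv z (bump r c) y \<partial>lborel"
  let ?B = "\<integral>y. v y * (dirderiv z ^^ 2) (bump r c) y \<partial>lborel"
  obtain K where K: "\<And>t. \<bar>t\<bar> \<le> 1 \<Longrightarrow> \<bar>mollify v r (c - t *\<^sub>R z) - (mollify v r c
      + ?A * t + ?B / 2 * t\<^sup>2)\<bar> \<le> K * \<bar>t\<bar> ^ 3"
    by (rule mollify_taylor2[OF v r, of c z]) (rule that)
  define h where "h t = mollify v r (c - t *\<^sub>R z) + e * (s \<bullet> (c - t *\<^sub>R z))\<^sup>2" for t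
  \<comment> \<open>The perturbation is exactly quadratic in \<open>t\<close>: it changes the
    coefficients but not the cubic error.\<close>
  have h_eq: "h t - ((mollify v r c + e * (s \<bullet> c)\<^sup>2) + (?A - 2 * e * (s \<bullet> c) * (s \<bullet> z)) * t
      + (?B / 2 + e * (s \<bullet> z)\<^sup>2) * t\<^sup>2)
    = mollify v r (c - t *\<^sub>R z) - (mollify v r c + ?A * t + ?B / 2 * t\<^sup>2)" for t
    by (simp add: h_def inner_diff_right power2_eq_square algebra_simps)
  have h: "\<bar>h t - ((mollify v r c + e * (s \<bullet> c)\<^sup>2) + (?A - 2 * e * (s \<bullet> c) * (s \<bullet> z)) * t
      + (?B / 2 + e * (s \<bullet> z)\<^sup>2) * t\<^sup>2)\<bar> \<le> K * \<bar>t\<bar> ^ 3" if "\<bar>t\<bar> \<le> 1" for t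
    unfolding h_eq by (rule K[OF that])
  \<comment> \<open>Adding 1 covers \<open>z = 0\<close> and makes
    \<open>\<bar>t\<bar> * norm z < d\<close> strict, so the segment stays in the open ball.\<close>
  have d': "d / (norm z + 1) > 0"
    using d by (simp add: add_nonneg_pos)
  have "h t \<le> mollify v r c + e * (s \<bullet> c)\<^sup>2" if t: "\<bar>t\<bar> \<le> d / (norm z + 1)" for t
  proof -
    have "\<bar>t\<bar> * (norm z + 1) \<le> d"
      using t by (simp add: pos_le_divide_eq add_nonneg_pos)
    then have "\<bar>t\<bar> * norm z < d"
      using d by (cases "t = 0") (auto simp: distrib_left)
    then have "c - t *\<^sub>R z \<in> ball c d"
      by (simp add: dist_norm)
    then show ?thesis
      unfolding h_def by (rule max)
  qed
  from local_max_second_order[OF h d' this]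
  show "?A = 2 * e * (s \<bullet> c) * (s \<bullet> z)" "?B \<le> - 2 * e * (s \<bullet> z)\<^sup>2"
    by auto
qed

context levy_measure
begin

text \<open>Testing with the bump at \<open>c\<close> turns the weak equation into a pointwise
  identity for the mollification at \<open>c\<close>.\<close>

lemma levy_op_mollify:
  fixes v :: "'a \<Rightarrow> real" and c :: 'a
  assumes v: "continuous_on UNIV v" "\<And>x. \<bar>v x\<bar> \<le> M" and r: "r \<ge> 0"
    and eq: "(\<integral>x. v x * levy_op P \<sigma> \<mu> (bump r c) x \<partial>lborel) = 0"
  shows "(\<Sum>i<P. \<integral>y. v y * (dirderiv (\<sigma> i) ^^ 2) (bump r c) y \<partial>lborel)
     + (\<integral>z. indicator (UNIV - {0}) z * (mollify v r (c - z) - mollify v r c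
    - (if norm z \<le> 1 then \<integral>y. v y * dirderiv z (bump r c) y \<partial>lborel else 0)) \<partial>\<mu>) = 0"
  using eq loc_part[OF v(1) r, of P \<sigma> c] nonlocal_part[OF v r, of c]
  by (simp add: levy_op_def distrib_left)

text \<open>The gradient term vanishes at the maximum, so equality of both nonpositive parts with
  zero gives the claim for almost every \<open>z\<close>. By continuity the exceptional set is open,
  and an open set that is null off 0 contains no support point.\<close>

lemma max_translate_supp:
  fixes v :: "'a \<Rightarrow> real"
  assumes v: "C0_fun v" and r: "r \<ge> 0"
    and eq: "(\<integral>x. v x * levy_op P \<sigma> \<mu> (bump r c) x \<partial>lborel) = 0"
    and max: "\<And>x. mollify v r x \<le> mollify v r c"
    and z: "z \<in> measure_supp \<mu>"
  shows "mollify v r (c - z) = mollify v r c"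
proof -
  have cont: "continuous_on UNIV v"
    using v by (simp add: C0_fun_def)
  obtain M where M: "\<And>x. \<bar>v x\<bar> \<le> M"
    using C0_fun_bounded[OF v] by blast
  define w where "w = mollify v r"
  have w: "continuous_on UNIV w"
    using mollify_C0[OF v r] by (simp add: w_def C0_fun_def)
  have A: "(\<integral>y. v y * dirderiv z (bump r c) y \<partial>lborel) = 0"
    and B: "(\<integral>y. v y * (dirderiv z ^^ 2) (bump r c) y \<partial>lborel) \<le> 0" for z
    \<comment> \<open>The maximum is global, so radius 1 will do, with no perturbation.\<close>
    using mollify_max_directional[OF cont M r, of c 1 0 0 z] max by auto
  define G where "G z = indicator (UNIV - {0}) z * (w (c - z) - w c)" for z
  have G_le: "G z \<le> 0" for z
    using max by (simp add: G_def w_def indicator_def)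
  have G_int: "integrable \<mu> G"
    using nonlocal_part(2)[OF cont M r, of c] unfolding A by (simp add: G_def[abs_def] w_def)
  have "(\<Sum>i<P. \<integral>y. v y * (dirderiv (\<sigma> i) ^^ 2) (bump r c) y \<partial>lborel) + (\<integral>z. G z \<partial>\<mu>) = 0"
    using levy_op_mollify[OF cont M r eq] unfolding A by (simp add: G_def w_def)
  moreover have "(\<Sum>i<P. \<integral>y. v y * (dirderiv (\<sigma> i) ^^ 2) (bump r c) y \<partial>lborel) \<le> 0"
    by (intro sum_nonpos B)
  moreover have "(\<integral>z. - G z \<partial>\<mu>) \<ge> 0"
    by (intro integral_nonneg_AE AE_I2) (simp add: G_le)
  ultimately have "(\<integral>z. - G z \<partial>\<mu>) = 0"
    by simp
  then have "AE z in \<mu>. - G z = 0"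
    by (subst (asm) integral_nonneg_eq_0_iff_AE) (use G_int G_le in auto)
  then have AE: "AE z in \<mu>. z \<notin> {z. w (c - z) < w c} - {0}"
    by eventually_elim (auto simp: G_def indicator_def split: if_splits)
  have op: "open {z. w (c - z) < w c}"
    by (intro open_Collect_less continuous_intros continuous_on_compose2[OF w]) auto
  have null: "emeasure \<mu> ({z. w (c - z) < w c} - {0}) = 0"
    using AE op by (subst (asm) AE_iff_measurable[OF _ refl])
      (auto simp: sets_mu space_mu intro!: sets.Diff borel_open)
  show ?thesis
  proof (rule ccontr)
    assume "mollify v r (c - z) \<noteq> mollify v r c"
    then have "z \<in> {z. w (c - z) < w c}"
      using max[of "c - z"] by (simp add: w_def)
    then obtain e where e: "e > 0" "ball z e \<subseteq> {z. w (c - z) < w c}"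
      using op open_contains_ball by blast
    have "emeasure \<mu> (ball z e - {0}) \<le> emeasure \<mu> ({z. w (c - z) < w c} - {0})"
      using e op by (intro emeasure_mono) (auto simp: sets_mu intro!: sets.Diff borel_open)
    then show False
      using z e(1) null by (auto simp: measure_supp_def)
  qed
qed

lemma mollify_nonpos_of_supp:
  fixes v :: "'a \<Rightarrow> real"
  assumes v: "C0_fun v" and r: "r \<ge> 0"
    and eq: "\<And>c. (\<integral>x. v x * levy_op P \<sigma> \<mu> (bump r c) x \<partial>lborel) = 0"
    and supp: "measure_supp \<mu> \<noteq> {}"
  shows "mollify v r a \<le> 0"
proof (rule ccontr)
  assume "\<not> mollify v r a \<le> 0"
  then obtain c where c: "\<And>x. mollify v r x \<le> mollify v r c" "mollify v r c > 0"
    using C0_fun_attains_max[OF mollify_C0[OF v r], of a] by auto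
  obtain z where z: "z \<in> measure_supp \<mu>" "z \<noteq> 0"
    using supp unfolding measure_supp_def by blast
  have const: "mollify v r (c - real n *\<^sub>R z) = mollify v r c" for n
  proof (induction n)
    case (Suc n)
    \<comment> \<open>By the induction hypothesis \<open>c - n z\<close> is itself a global maximum
      point, so the translation argument applies again there.\<close>
    have "mollify v r (c - real n *\<^sub>R z - z) = mollify v r (c - real n *\<^sub>R z)"
      by (rule max_translate_supp[OF v r eq _ z(1)]) (simp add: Suc c)
    then show ?case
      by (simp add: Suc algebra_simps)
  qed simp
  have "(mollify v r \<longlongrightarrow> 0) at_infinity"
    using mollify_C0[OF v r] by (simp add: C0_fun_def)
  then obtain R where R: "\<And>x. norm x \<ge> R \<Longrightarrow> \<bar>mollify v r x\<bar> < mollify v r c"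
    using tendstoD[OF _ c(2)] by (fastforce simp: eventually_at_infinity dist_norm)
  obtain n where n: "(R + norm c) / norm z \<le> real n"
    using real_arch_simple by blast
  have "R + norm c \<le> norm (real n *\<^sub>R z)"
    using n z(2) by (simp add: pos_divide_le_eq)
  also have "\<dots> \<le> norm (c - real n *\<^sub>R z) + norm c"
    by (metis norm_minus_commute norm_triangle_sub add.commute)
  finally show False
    using R[of "c - real n *\<^sub>R z"] const[of n] by simp
qed

text \<open>A degenerate diffusion only gives vanishing second derivatives at a maximum, so the maximum
  is made strict by adding a small multiple of \<open>(\<sigma>\<^sub>i \<bullet> x)\<^sup>2\<close>.\<close>

lemma mollify_nonpos_of_diffusion:
  fixes v :: "'a \<Rightarrow> real"
  assumes v: "C0_fun v" and r: "r \<ge> 0"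
    and eq: "\<And>c. (\<integral>x. v x * levy_op P \<sigma> \<mu> (bump r c) x \<partial>lborel) = 0"
    and supp: "measure_supp \<mu> = {}" and i: "i < P" "\<sigma> i \<noteq> 0"
  shows "mollify v r a \<le> 0"
proof (rule ccontr)
  define w where "w = mollify v r"
  assume "\<not> mollify v r a \<le> 0"
  then have pos: "w a > 0" by (simp add: w_def)
  have cont: "continuous_on UNIV v"
    using v by (simp add: C0_fun_def)
  obtain M where M: "\<And>x. \<bar>v x\<bar> \<le> M"
    using C0_fun_bounded[OF v] by blast
  have w: "continuous_on UNIV w" "(w \<longlongrightarrow> 0) at_infinity"
    using mollify_C0[OF v r] by (auto simp: w_def C0_fun_def)
  obtain R0 where R0: "\<And>x. norm x \<ge> R0 \<Longrightarrow> \<bar>w x\<bar> < w a / 2"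
    using tendstoD[OF w(2), of "w a / 2"] pos by (fastforce simp: eventually_at_infinity dist_norm)
  define R where "R = max R0 (norm a + 1)"
  have R: "R > 0" "a \<in> cball 0 R" "\<And>x. norm x = R \<Longrightarrow> w x < w a / 2"
  proof -
    show "R > 0" "a \<in> cball 0 R"
      by (auto simp: R_def add_nonneg_pos less_max_iff_disj)
    show "w x < w a / 2" if "norm x = R" for x
      using R0[of x] that by (simp add: R_def)
  qed
  let ?s = "\<sigma> i"
  \<comment> \<open>With this \<open>e\<close> the perturbation is at most \<open>w a / 2\<close> on
    the ball. On the sphere the sum is then below \<open>w a\<close>, hence below the value at
    \<open>a\<close>, and the maximum is interior.\<close>
  define e where "e = w a / (2 * (norm ?s * R)\<^sup>2)"
  have sR: "norm ?s * R > 0"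
    using i R by simp
  have e: "e > 0" "e * (norm ?s * R)\<^sup>2 = w a / 2"
  proof -
    have sq: "(norm ?s * R)\<^sup>2 > 0"
      by (rule zero_less_power[OF sR])
    then show "e > 0"
      unfolding e_def by (intro divide_pos_pos mult_pos_pos) (use pos in auto)
    show "e * (norm ?s * R)\<^sup>2 = w a / 2"
      using R(1) i(2) by (simp add: e_def)
  qed
  define h where "h x = w x + e * (?s \<bullet> x)\<^sup>2" for x
  have "continuous_on (cball 0 R) h"
    unfolding h_def by (intro continuous_intros continuous_on_subset[OF w(1)]) auto
  then have "\<exists>c\<in>cball 0 R. \<forall>x\<in>cball 0 R. h x \<le> h c"
    using R(1) by (intro continuous_attains_sup) auto
  then obtain c where c: "c \<in> cball 0 R" "\<And>x. x \<in> cball 0 R \<Longrightarrow> h x \<le> h c"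
    by blast
  have "norm c \<noteq> R"
  proof
    assume n: "norm c = R"
    have "(?s \<bullet> c)\<^sup>2 \<le> (norm ?s * R)\<^sup>2"
      using Cauchy_Schwarz_ineq2[of ?s c] n R(1) by (simp add: abs_le_square_iff[symmetric] abs_mult)
    then have "e * (?s \<bullet> c)\<^sup>2 \<le> w a / 2"
      using e by (metis mult_left_mono less_imp_le)
    then have "h c < w a"
      using R(3)[OF n] by (simp add: h_def)
    moreover have "h a \<ge> w a"
      using e by (simp add: h_def)
    ultimately show False
      using c(2)[OF R(2)] by simp
  qed
  then have d: "R - norm c > 0"
    using c(1) by simp
  have in_cball: "x \<in> cball 0 R" if "x \<in> ball c (R - norm c)" for x
    using that norm_triangle_sub[of x c] by (simp add: dist_norm norm_minus_commute)
  have B: "(\<integral>y. v y * (dirderiv z ^^ 2) (bump r c) y \<partial>lborel) \<le> - 2 * e * (?s \<bullet> z)\<^sup>2" for z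
    by (rule mollify_max_directional(2)[OF cont M r _ d])
       (use c(2)[OF in_cball] in \<open>auto simp: h_def w_def\<close>)
  have "(\<Sum>j<P. \<integral>y. v y * (dirderiv (\<sigma> j) ^^ 2) (bump r c) y \<partial>lborel)
    \<le> (\<Sum>j<P. - 2 * e * (?s \<bullet> \<sigma> j)\<^sup>2)"
    by (intro sum_mono B)
  also have "\<dots> = - 2 * e * (\<Sum>j<P. (?s \<bullet> \<sigma> j)\<^sup>2)"
    by (simp add: sum_distrib_left)
  also have "\<dots> < 0"
  proof -
    \<comment> \<open>The term \<open>j = i\<close> is positive and the others are
      nonnegative.\<close>
    have "(\<Sum>j<P. (?s \<bullet> \<sigma> j)\<^sup>2) > 0"
      by (rule sum_pos2[of _ i]) (use i in auto)
    then show ?thesis using e(1) by simp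
  qed
  finally have "(\<Sum>j<P. \<integral>y. v y * (dirderiv (\<sigma> j) ^^ 2) (bump r c) y \<partial>lborel) < 0" .
  moreover have "(\<integral>z. indicator (UNIV - {0}) z * (mollify v r (c - z) - mollify v r c
    - (if norm z \<le> 1 then \<integral>y. v y * dirderiv z (bump r c) y \<partial>lborel else 0)) \<partial>\<mu>) = 0"
  proof (rule integral_eq_zero_AE)
    \<comment> \<open>With empty support the measure vanishes off 0, and the indicator kills the
      integrand at 0.\<close>
    have "AE z in \<mu>. z \<notin> UNIV - {0}"
      using emeasure_supp_empty[OF sets_mu supp]
      by (intro AE_not_in) (auto simp: null_sets_def sets_mu)
    then show "AE z in \<mu>. indicator (UNIV - {0}) z * (mollify v r (c - z) - mollify v r c
      - (if norm z \<le> 1 then \<integral>y. v y * dirderiv z (bump r c) y \<partial>lborel else 0)) = 0"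
      by eventually_elim auto
  qed
  ultimately show False
    using levy_op_mollify[OF cont M r eq, of c] by simp
qed

text \<open>One-sided form, to be applied to both \<open>v\<close> and \<open>- v\<close>. A
  positive value of \<open>v\<close> survives mollification by a narrow bump, and emptiness of the
  support decides which maximum argument excludes it.\<close>

lemma C0_solution_nonpos:
  fixes v :: "'a \<Rightarrow> real"
  assumes nontriv: "(\<exists>i<P. \<sigma> i \<noteq> 0) \<or> measure_supp \<mu> \<noteq> {}" and v: "C0_fun v"
    and eq: "\<And>\<psi>. test_fun \<psi> \<Longrightarrow> (\<integral>x. v x * levy_op P \<sigma> \<mu> \<psi> x \<partial>lborel) = 0"
  shows "v x \<le> 0"
proof (rule ccontr)
  assume "\<not> v x \<le> 0"
  then obtain r where r: "r > 0" "mollify v r x > 0"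
    using mollify_pos[of v x] v by (auto simp: C0_fun_def)
  have "mollify v r x \<le> 0"
    using mollify_nonpos_of_supp[OF v _ eq[OF test_fun_bump]]
      mollify_nonpos_of_diffusion[OF v _ eq[OF test_fun_bump]] nontriv r(1)
    by (metis less_imp_le)
  with r show False by simp
qed

end

theorem theorem4:
  fixes P :: nat and \<sigma> :: "nat \<Rightarrow> 'a::euclidean_space"
    and \<mu> :: "'a measure" and v :: "'a \<Rightarrow> real"
  assumes sets_mu: "sets \<mu> = sets borel"
    and no_zero: "emeasure \<mu> {0} = 0"
    and radon: "\<And>K. compact K \<Longrightarrow> 0 \<notin> K \<Longrightarrow> emeasure \<mu> K < \<infinity>"
    and symm: "\<And>A. A \<in> sets borel \<Longrightarrow> emeasure \<mu> (uminus ` A) = emeasure \<mu> A"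
    and levy: "(\<integral>\<^sup>+ z. ennreal (min ((norm z)\<^sup>2) 1) \<partial>\<mu>) < \<infinity>"
    and nontriv: "(\<exists>i<P. \<sigma> i \<noteq> 0) \<or> measure_supp \<mu> \<noteq> {}"
    and v_C0: "C0_fun v"
    and eq: "\<And>\<psi>. test_fun \<psi> \<Longrightarrow> (\<integral>x. v x * levy_op P \<sigma> \<mu> \<psi> x \<partial>lborel) = 0"
  shows "\<forall>x. v x = 0"
proof
  fix x
  interpret levy_measure \<mu>
    by unfold_locales (fact sets_mu no_zero radon levy)+
  have "C0_fun (\<lambda>x. - v x)"
    using v_C0 by (auto simp: C0_fun_def intro: continuous_on_minus dest: tendsto_minus)
  \<comment> \<open>The weak equation is linear in \<open>v\<close>, so it holds for
    \<open>- v\<close> as well.\<close>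
  then have "- v x \<le> 0"
    by (rule C0_solution_nonpos[OF nontriv]) (simp add: eq)
  moreover have "v x \<le> 0"
    by (rule C0_solution_nonpos[OF nontriv v_C0 eq])
  ultimately show "v x = 0" by simp
qed

end
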